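(* Let $G$ be a connected graph and let $\{F_1,\ldots,F_r\}$ be a c-partition of $E(G)$. Then for every two edges $e,f \in E(G)$, $$d_G(e,f)=\sum_{i=1}^r d_{G/F_i}(\alpha_i(e),\alpha_i(f)).$$
   Context: All graphs are finite and simple; $d_G(u,v)$ is the usual shortest-path distance between vertices. For a vertex $v$ and an edge $e=xy$, $d_G(v,e)=\min\{d_G(v,x),d_G(v,y)\}$. For edges $e=xy$, $f=ab$, $d_G(e,f)=\min\{d_G(x,a),d_G(x,b),d_G(y,a),d_G(y,b)\}$. These three notions are applied in any graph (in particular in $G/F_i$) to pairs of vertices/edges. Two edges $e=xy$, $f=ab$ of $G$ are in relation $\Theta$ if $d_G(x,a)+d_G(y,b)\neq d_G(x,b)+d_G(y,a)$; $\Theta^*$ is the transitive closure of $\Theta$, an equivalence relation on $E(G)$, whose classes form the $\Theta^*$-partition. A partition $\{F_1,\ldots,F_r\}$ of $E(G)$ is a c-partition if every $\Theta^*$-class is contained in some $F_i$. For $E'\subseteq E(G)$, the quotient graph $G/E'$ has as vertices the connected components of $G\setminus E'$ (the graph obtained from $G$ by deleting the edges in $E'$), two components $X,Y$ being adjacent iff some vertex of $X$ is adjacent in $G$ to some vertex of $Y$. For each $i$, $\ell_i:V(G)\to V(G/F_i)$ maps $v$ to the component of $G\setminus F_i$ containing $v$, and $\alpha_i:E(G)\to V(G/F_i)\cup E(G/F_i)$ is defined by $\alpha_i(xy)=\ell_i(x)$ if $\ell_i(x)=\ell_i(y)$, and $\alpha_i(xy)=\ell_i(x)\ell_i(y)\in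 E(G/F_i)$ if $\ell_i(x)\neq\ell_i(y)$. *)

theory Defs
  imports Main "HOL-Library.Disjoint_Sets" "HOL-Library.Extended_Nat"
begin

record 'a ugraph =
  verts :: "'a set"
  edges :: "'a set set"

definition simple_graph :: "'a ugraph \<Rightarrow> bool" where
  "simple_graph G \<longleftrightarrow> finite (verts G) \<and> (\<forall>e\<in>edges G. e \<subseteq> verts G \<and> card e = 2)"

definition adj :: "'a ugraph \<Rightarrow> 'a \<Rightarrow> 'a \<Rightarrow> bool" where
  "adj G x y \<longleftrightarrow> {x, y} \<in> edges G"

definition walks :: "'a ugraph \<Rightarrow> 'a \<Rightarrow> 'a \<Rightarrow> 'a list set" where
  "walks G u v = {p. p \<noteq> [] \<and> hd p = u \<and> last p = v \<and> set p \<subseteq> verts G \<and> successively (adj G) p}"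

definition connected_graph :: "'a ugraph \<Rightarrow> bool" where
  "connected_graph G \<longleftrightarrow> verts G \<noteq> {} \<and> (\<forall>u\<in>verts G. \<forall>v\<in>verts G. walks G u v \<noteq> {})"

text \<open>A shortest walk is a path, so this is the usual shortest-path distance; it is
  \<^term>\<open>\<infinity>\<close> exactly if there is no walk.\<close>

definition vdist :: "'a ugraph \<Rightarrow> 'a \<Rightarrow> 'a \<Rightarrow> enat" where
  "vdist G u v = (INF p\<in>walks G u v. enat (length p - 1))"

definition vertex_edge_dist :: "'a ugraph \<Rightarrow> 'a \<Rightarrow> 'a set \<Rightarrow> enat" where
  "vertex_edge_dist G v e = Min {vdist G v x |x. x \<in> e}"

definition edge_dist :: "'a ugraph \<Rightarrow> 'a set \<Rightarrow> 'a set \<Rightarrow> enat" where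
  "edge_dist G e f = Min {vdist G x a |x a. x \<in> e \<and> a \<in> f}"

text \<open>Distance between elements of the disjoint union of vertices (\<^const>\<open>Inl\<close>) and
  edges (\<^const>\<open>Inr\<close>).\<close>

fun elem_dist :: "'a ugraph \<Rightarrow> 'a + 'a set \<Rightarrow> 'a + 'a set \<Rightarrow> enat" where
  "elem_dist G (Inl u) (Inl v) = vdist G u v"
| "elem_dist G (Inl u) (Inr f) = vertex_edge_dist G u f"
| "elem_dist G (Inr e) (Inl v) = vertex_edge_dist G v e"
| "elem_dist G (Inr e) (Inr f) = edge_dist G e f"

text \<open>The disequality is invariant under exchanging the two ends of an edge, so it does not
  matter how the ends of \<open>e\<close> and \<open>f\<close> are named.\<close>

definition Theta :: "'a ugraph \<Rightarrow> ('a set \<times> 'a set) set" where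
  "Theta G = {(e, f). e \<in> edges G \<and> f \<in> edges G \<and>
     (\<exists>x y a b. e = {x, y} \<and> f = {a, b} \<and>
        vdist G x a + vdist G y b \<noteq> vdist G x b + vdist G y a)}"

definition Theta_star :: "'a ugraph \<Rightarrow> ('a set \<times> 'a set) set" where
  "Theta_star G = (Theta G)\<^sup>+"

definition c_partition :: "'a ugraph \<Rightarrow> 'a set set set \<Rightarrow> bool" where
  "c_partition G P \<longleftrightarrow> partition_on (edges G) P \<and>
     (\<forall>C\<in>edges G // Theta_star G. \<exists>F\<in>P. C \<subseteq> F)"

definition delete_edges :: "'a ugraph \<Rightarrow> 'a set set \<Rightarrow> 'a ugraph" where
  "delete_edges G F = \<lparr>verts = verts G, edges = edges G - F\<rparr>"

definition component_of :: "'a ugraph \<Rightarrow> 'a \<Rightarrow> 'a set" where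
  "component_of G v = {w. walks G v w \<noteq> {}}"

definition components :: "'a ugraph \<Rightarrow> 'a set set" where
  "components G = component_of G ` verts G"

definition quotient_graph :: "'a ugraph \<Rightarrow> 'a set set \<Rightarrow> 'a set ugraph" where
  "quotient_graph G F =
     \<lparr>verts = components (delete_edges G F),
      edges = {{X, Y} |X Y. X \<in> components (delete_edges G F) \<and>
                 Y \<in> components (delete_edges G F) \<and> X \<noteq> Y \<and> (\<exists>x\<in>X. \<exists>y\<in>Y. adj G x y)}\<rparr>"

definition ell :: "'a ugraph \<Rightarrow> 'a set set \<Rightarrow> 'a \<Rightarrow> 'a set" where
  "ell G F v = component_of (delete_edges G F) v"

text \<open>Since \<open>ell G F ` {x, y} = {ell G F x, ell G F y}\<close>, the image is a singleton iff the ends of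
  the edge lie in the same component; see \<open>alpha_edge\<close>.\<close>

definition alpha :: "'a ugraph \<Rightarrow> 'a set set \<Rightarrow> 'a set \<Rightarrow> 'a set + 'a set set" where
  "alpha G F e =
     (if is_singleton (ell G F ` e) then Inl (the_elem (ell G F ` e)) else Inr (ell G F ` e))"

lemma alpha_edge:
  "alpha G F {x, y} =
     (if ell G F x = ell G F y then Inl (ell G F x) else Inr {ell G F x, ell G F y})"
  by (auto simp: alpha_def is_singleton_def)

lemma vertex_edge_dist_edge:
  "vertex_edge_dist G v {x, y} = min (vdist G v x) (vdist G v y)"
proof -
  have "{vdist G v z |z. z \<in> {x, y}} = {vdist G v x, vdist G v y}" by auto
  then show ?thesis by (simp add: vertex_edge_dist_def)
qed

lemma edge_dist_edge:
  "edge_dist G {x, y} {a, b} = Min {vdist G x a, vdist G x b, vdist G y a, vdist G y b}"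
  unfolding edge_dist_def by (rule arg_cong[where f = Min]) auto

end

theory Submission
  imports Defs
begin

text \<open>Fix vertices \<open>u\<close>, \<open>v\<close> and a walk \<open>P\<close> from \<open>u\<close> to \<open>v\<close>, and let \<open>h\<^sub>i z\<close> be the sum of
  \<open>d(z,a) - d(z,b)\<close> over the steps \<open>ab\<close> of \<open>P\<close> in \<open>F\<^sub>i\<close>. Edges outside \<open>F\<^sub>i\<close> are not in relation \<open>\<Theta>\<close>
  to edges of \<open>F\<^sub>i\<close>, so \<open>h\<^sub>i\<close> is constant along them; along an edge \<open>xy\<close> of \<open>F\<^sub>i\<close> the sum may be
  extended to all of \<open>P\<close>, where it telescopes and shows that \<open>h\<^sub>i\<close> grows by at most \<open>2\<close>. Hence every
  walk from \<open>u\<close> to \<open>v\<close> has at least \<open>(h\<^sub>i v - h\<^sub>i u) / 2\<close> edges in \<open>F\<^sub>i\<close>. The sum of these bounds over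
  \<open>i\<close> is \<open>d(u,v)\<close>, the number of all edges on a shortest walk, so a shortest walk attains each of them;
  and the minimal number of edges in \<open>F\<^sub>i\<close> on a walk is the distance in \<open>G/F\<^sub>i\<close>. This proves the analogous formula for vertices. For edges \<open>e \<in> F\<^sub>j\<close> and \<open>f \<in> F\<^sub>k\<close>, the choice of an end of
  \<open>e\<close> matters only in \<open>G/F\<^sub>j\<close> and that of an end of \<open>f\<close> only in \<open>G/F\<^sub>k\<close>, so some pair of ends
  realizes the minimal distance in all quotients at once.\<close>

section \<open>Sums over the steps of a walk\<close>

fun step_sum :: "('a \<Rightarrow> 'a \<Rightarrow> 'b::comm_monoid_add) \<Rightarrow> 'a list \<Rightarrow> 'b" where
  "step_sum g [] = 0"
| "step_sum g [x] = 0"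
| "step_sum g (x # y # p) = g x y + step_sum g (y # p)"

lemma step_sum_append:
  assumes "p \<noteq> []" "q \<noteq> []"
  shows "step_sum g (p @ q) = step_sum g p + g (last p) (hd q) + step_sum g q"
  using assms
proof (induction g p rule: step_sum.induct)
  case (2 g x)
  then show ?case by (cases q) auto
qed (auto simp: add.assoc)

lemma step_sum_telescope:
  fixes g :: "'a \<Rightarrow> 'b::ab_group_add"
  shows "p \<noteq> [] \<Longrightarrow> step_sum (\<lambda>x y. g y - g x) p = g (last p) - g (hd p)"
  by (induction p rule: induct_list012) auto

lemma step_sum_cong:
  assumes "successively R p" "\<And>x y. R x y \<Longrightarrow> g x y = h x y"
  shows "step_sum g p = step_sum h p"
  using assms by (induction p rule: induct_list012) auto

lemma step_sum_mono:
  fixes g :: "'a \<Rightarrow> 'a \<Rightarrow> 'b::ordered_comm_monoid_add"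
  assumes "successively R p" "\<And>x y. R x y \<Longrightarrow> g x y \<le> h x y"
  shows "step_sum g p \<le> step_sum h p"
  using assms by (induction p rule: induct_list012) (auto intro: add_mono)

lemma step_sum_diff:
  fixes g :: "'a \<Rightarrow> 'a \<Rightarrow> 'b::ab_group_add"
  shows "step_sum g p - step_sum h p = step_sum (\<lambda>x y. g x y - h x y) p"
  by (induction p rule: induct_list012) (auto simp: algebra_simps)

lemma step_sum_sum:
  "(\<Sum>i\<in>I. step_sum (g i) p) = step_sum (\<lambda>x y. \<Sum>i\<in>I. g i x y) p"
  by (induction p rule: induct_list012) (auto simp: sum.distrib)

lemma step_sum_1: "step_sum (\<lambda>_ _. 1) p = length p - 1"
  by (induction p rule: induct_list012) auto

text \<open>A step in \<open>F\<close> counts even if its ends share a component after deleting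
  \<open>F\<close>, so this may exceed the length of the projected walk.\<close>

definition crossings :: "'a set set \<Rightarrow> 'a list \<Rightarrow> nat" where
  "crossings F = step_sum (\<lambda>x y. of_bool ({x, y} \<in> F))"

text \<open>The factor 2 matches the bound on the growth of \<open>h\<close> along an edge of its
  block.\<close>

lemma int_crossings:
  "2 * int (crossings F p) = step_sum (\<lambda>x y. if {x, y} \<in> F then 2 else 0) p"
  unfolding crossings_def by (induction p rule: induct_list012) auto

section \<open>Walks and distances\<close>

lemma adj_commute: "adj G x y \<longleftrightarrow> adj G y x"
  by (simp add: adj_def insert_commute)

lemma walks_rev:
  assumes "p \<in> walks G u v"
  shows "rev p \<in> walks G v u"
proof -
  have "successively (adj G) (rev p)"
    unfolding successively_rev
    by (rule successively_mono[of "adj G"]) (use assms in \<open>simp_all add: walks_def adj_commute\<close>)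
  with assms show ?thesis
    by (simp add: walks_def hd_rev last_rev)
qed

lemma walks_append:
  assumes "p \<in> walks G u x" "adj G x y" "q \<in> walks G y v"
  shows "p @ q \<in> walks G u v"
  using assms by (auto simp: walks_def successively_append_iff)

lemma walks_trans:
  assumes "p \<in> walks G u x" "q \<in> walks G x v"
  shows "p @ tl q \<in> walks G u v"
proof (cases q rule: remdups_adj.cases)
  case (3 x' y q')
  with assms have "adj G x y" "y # q' \<in> walks G y v" by (auto simp: walks_def)
  with assms walks_append 3 show ?thesis by fastforce
qed (use assms in \<open>auto simp: walks_def\<close>)

lemma walks_singleton: "u \<in> verts G \<Longrightarrow> [u] \<in> walks G u u"
  by (simp add: walks_def)

lemma vdist_le: "p \<in> walks G u v \<Longrightarrow> vdist G u v \<le> enat (length p - 1)"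
  unfolding vdist_def by (rule INF_lower)

lemma vdist_attained:
  assumes "walks G u v \<noteq> {}"
  obtains p where "p \<in> walks G u v" "vdist G u v = enat (length p - 1)"
proof -
  have "vdist G u v \<in> (\<lambda>p. enat (length p - 1)) ` walks G u v"
    unfolding vdist_def by (rule wellorder_InfI[where k = "enat (length (SOME p. p \<in> walks G u v) - 1)"])
      (use assms in \<open>auto intro: someI\<close>)
  then show ?thesis using that by blast
qed

lemma vdist_commute: "vdist G u v = vdist G v u"
proof -
  have "vdist G u v \<le> vdist G v u" for u v
    unfolding vdist_def[of G v u]
    using vdist_le[OF walks_rev] by (intro INF_greatest) fastforce
  then show ?thesis by (simp add: order_antisym)
qed

lemma vdist_adj_le:
  assumes "adj G x y" "x \<in> verts G" "walks G y v \<noteq> {}"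
  shows "vdist G x v \<le> vdist G y v + 1"
proof -
  obtain p where p: "p \<in> walks G y v" "vdist G y v = enat (length p - 1)"
    using vdist_attained[OF assms(3)] .
  have "[x] @ p \<in> walks G x v"
    using walks_append[OF walks_singleton[OF assms(2)] assms(1) p(1)] .
  from vdist_le[OF this] p show ?thesis
    by (cases p) (auto simp: walks_def one_enat_def)
qed

lemma edge_vertices:
  assumes "simple_graph G" "adj G x y"
  shows "x \<in> verts G" "y \<in> verts G" "x \<noteq> y"
  using assms unfolding simple_graph_def adj_def
  by (auto dest!: bspec[where x = "{x, y}"])

section \<open>Distances in a quotient graph\<close>

text \<open>Reachability after the deletion becomes a property of walks in \<open>G\<close>, which
  can then be joined with arbitrary walks of \<open>G\<close>.\<close>

lemma walks_delete_edges:
  "p \<in> walks (delete_edges G F) u v \<longleftrightarrow> p \<in> walks G u v \<and> crossings F p = 0"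
proof -
  have "successively (adj (delete_edges G F)) p
    \<longleftrightarrow> successively (adj G) p \<and> crossings F p = 0"
    unfolding crossings_def
    by (induction p rule: induct_list012) (auto simp: adj_def delete_edges_def)
  then show ?thesis by (auto simp: walks_def delete_edges_def)
qed

lemma ell_eqI:
  assumes "walks (delete_edges G F) u v \<noteq> {}"
  shows "ell G F u = ell G F v"
proof -
  have "walks (delete_edges G F) w z \<noteq> {}"
    if "walks (delete_edges G F) u' w \<noteq> {}" "walks (delete_edges G F) u' z \<noteq> {}" for u' w z
    using that walks_rev walks_trans by (metis ex_in_conv)
  moreover have "walks (delete_edges G F) v u \<noteq> {}"
    using assms walks_rev by (metis ex_in_conv)
  ultimately show ?thesis
    using assms walks_trans unfolding ell_def component_of_def by blast
qed

lemma ell_refl: "u \<in> verts G \<Longrightarrow> u \<in> ell G F u"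
  unfolding ell_def component_of_def
  using walks_singleton[of u "delete_edges G F"] by (auto simp: delete_edges_def)

lemma ell_eqD:
  assumes "ell G F u = ell G F v" "v \<in> verts G"
  obtains p where "p \<in> walks G u v" "crossings F p = 0"
proof -
  have "v \<in> ell G F u" using assms ell_refl by metis
  then obtain p where "p \<in> walks (delete_edges G F) u v"
    by (auto simp: ell_def component_of_def)
  then show ?thesis using that unfolding walks_delete_edges by blast
qed

lemma ell_eq_adj:
  assumes "simple_graph G" "adj G x y" "{x, y} \<notin> F"
  shows "ell G F x = ell G F y"
proof (rule ell_eqI)
  have "[x, y] \<in> walks (delete_edges G F) x y"
    using assms edge_vertices[OF assms(1,2)] by (auto simp: walks_def delete_edges_def adj_def)
  then show "walks (delete_edges G F) x y \<noteq> {}" by blast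
qed

lemma verts_quotient: "verts (quotient_graph G F) = ell G F ` verts G"
  by (auto simp: quotient_graph_def components_def ell_def delete_edges_def)

lemma ell_eq_of_mem:
  assumes "X \<in> verts (quotient_graph G F)" "x \<in> X"
  shows "x \<in> verts G" "ell G F x = X"
proof -
  obtain u where u: "X = ell G F u" using assms(1) by (auto simp: verts_quotient)
  with assms(2) have w: "walks (delete_edges G F) u x \<noteq> {}"
    by (auto simp: ell_def component_of_def)
  show "ell G F x = X" using ell_eqI[OF w] u by simp
  show "x \<in> verts G" using w by (auto simp: walks_def delete_edges_def)
qed

lemma adj_quotient_iff:
  "adj (quotient_graph G F) X Y \<longleftrightarrow>
    X \<in> verts (quotient_graph G F) \<and> Y \<in> verts (quotient_graph G F) \<and> X \<noteq> Y \<and>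
    (\<exists>x\<in>X. \<exists>y\<in>Y. adj G x y)"
proof -
  have "(\<exists>x\<in>X. \<exists>y\<in>Y. adj G x y) \<longleftrightarrow> (\<exists>x\<in>Y. \<exists>y\<in>X. adj G x y)"
    using adj_commute by metis
  then show ?thesis
    unfolding adj_def[of "quotient_graph G F"] unfolding quotient_graph_def
    by (auto simp: doubleton_eq_iff)
qed

lemma adj_quotientI:
  assumes "simple_graph G" "adj G x y" "ell G F x \<noteq> ell G F y"
  shows "adj (quotient_graph G F) (ell G F x) (ell G F y)"
  using assms edge_vertices[OF assms(1,2)] ell_refl[of x G F] ell_refl[of y G F]
  unfolding adj_quotient_iff verts_quotient by blast

text \<open>Project the walk: a step inside a component vanishes; a step between two components is a
  quotient edge and belongs to \<open>F\<close>. Existence of a quotient walk is carried along for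
  \<open>vdist_adj_le\<close>.\<close>

lemma vdist_quotient_le:
  assumes "simple_graph G"
  shows "p \<in> walks G u v \<Longrightarrow>
    walks (quotient_graph G F) (ell G F u) (ell G F v) \<noteq> {} \<and>
    vdist (quotient_graph G F) (ell G F u) (ell G F v) \<le> enat (crossings F p)"
proof (induction p arbitrary: u rule: induct_list012)
  case (2 x)
  then have "x \<in> verts G" "u = x" "v = x" by (auto simp: walks_def)
  then have "[ell G F x] \<in> walks (quotient_graph G F) (ell G F u) (ell G F v)"
    using walks_singleton[of "ell G F x" "quotient_graph G F"] by (simp add: verts_quotient)
  with vdist_le[OF this] show ?case by (auto simp: crossings_def)
next
  case (3 x y p)
  let ?H = "quotient_graph G F"
  have xy: "u = x" "adj G x y" "y # p \<in> walks G y v" using 3(3) by (auto simp: walks_def)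
  note IH = 3(2)[OF xy(3)]
  show ?case
  proof (cases "ell G F x = ell G F y")
    case True
    have "crossings F (y # p) \<le> crossings F (x # y # p)" by (simp add: crossings_def)
    with IH True xy(1) show ?thesis by (metis enat_ord_simps(1) order_trans)
  next
    case False
    have "ell G F x \<in> verts ?H"
      using edge_vertices[OF assms xy(2)] by (auto simp: verts_quotient)
    note x = adj_quotientI[OF assms xy(2) False] this
    obtain q where "q \<in> walks ?H (ell G F y) (ell G F v)" using IH by blast
    from walks_append[OF walks_singleton[OF x(2)] x(1) this]
    have ne: "walks ?H (ell G F u) (ell G F v) \<noteq> {}" using xy(1) by blast
    have "vdist ?H (ell G F x) (ell G F v) \<le> vdist ?H (ell G F y) (ell G F v) + 1"
      using vdist_adj_le[OF x] IH by blast
    also have "\<dots> \<le> enat (crossings F (y # p)) + 1" using IH by (simp add: add_right_mono)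
    also have "\<dots> = enat (crossings F (x # y # p))"
      using ell_eq_adj[OF assms xy(2), of F] False by (auto simp: crossings_def one_enat_def)
    finally show ?thesis using ne xy(1) by simp
  qed
qed (simp add: walks_def)

text \<open>Every quotient edge comes from an edge of \<open>G\<close>, and successive ones are
  linked inside a component by a walk avoiding \<open>F\<close>; only the lifted edges can be
  crossings.\<close>

lemma lift_quotient_walk:
  assumes "v \<in> verts G"
  shows "q \<in> walks (quotient_graph G F) (ell G F u) (ell G F v) \<Longrightarrow>
    \<exists>p\<in>walks G u v. crossings F p \<le> length q - 1"
proof (induction q arbitrary: u rule: induct_list012)
  case (2 X)
  then have "ell G F u = ell G F v" by (auto simp: walks_def)
  then obtain p where "p \<in> walks G u v" "crossings F p = 0" using ell_eqD assms by metis
  then show ?case by auto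
next
  case (3 X Y q)
  let ?H = "quotient_graph G F"
  have X: "ell G F u = X" "X \<in> verts ?H" "Y \<in> verts ?H" "adj ?H X Y" "Y # q \<in> walks ?H Y (ell G F v)"
    using 3(3) by (auto simp: walks_def)
  obtain x y where xy: "x \<in> X" "y \<in> Y" "adj G x y" using X(4) unfolding adj_quotient_iff by blast
  note x = ell_eq_of_mem[OF X(2) xy(1)] and y = ell_eq_of_mem[OF X(3) xy(2)]
  obtain p1 where p1: "p1 \<in> walks G u x" "crossings F p1 = 0"
    using ell_eqD[of G F u x] x X(1) by metis
  obtain p2 where p2: "p2 \<in> walks G y v" "crossings F p2 \<le> length q"
    using 3(2)[of y] X(5) y(2) by auto
  have "p1 \<noteq> []" "p2 \<noteq> []" using p1 p2 by (auto simp: walks_def)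
  then have "crossings F (p1 @ p2) \<le> 1 + length q"
    using p1(2) p2(2) by (auto simp: crossings_def step_sum_append)
  with walks_append[OF p1(1) xy(3) p2(1)] show ?case by auto
qed (simp add: walks_def)

text \<open>A shortest quotient walk is lifted, and projecting the lift back excludes strict
  inequality.\<close>

lemma vdist_quotient_attained:
  assumes "simple_graph G" "connected_graph G" "u \<in> verts G" "v \<in> verts G"
  obtains q where "q \<in> walks G u v"
    "vdist (quotient_graph G F) (ell G F u) (ell G F v) = enat (crossings F q)"
proof -
  let ?H = "quotient_graph G F"
  obtain p where "p \<in> walks G u v" using assms unfolding connected_graph_def by blast
  then have "walks ?H (ell G F u) (ell G F v) \<noteq> {}" using vdist_quotient_le[OF assms(1)] by blast
  then obtain q where q: "q \<in> walks ?H (ell G F u) (ell G F v)"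
    "vdist ?H (ell G F u) (ell G F v) = enat (length q - 1)" by (rule vdist_attained)
  obtain p where p: "p \<in> walks G u v" "crossings F p \<le> length q - 1"
    using lift_quotient_walk[OF assms(4) q(1)] by blast
  with vdist_quotient_le[OF assms(1) p(1), of F] q(2) that show ?thesis by simp
qed

section \<open>The distance formula for vertices\<close>

text \<open>The block around the class of \<open>e\<close> contains \<open>f\<close>. It also
  contains \<open>e\<close>, since \<Theta> is reflexive on edges (0 + 0 differs from 2 d(x,y)), so
  by disjointness it is \<open>F\<close>.\<close>

lemma c_partition_Theta:
  assumes "simple_graph G" "c_partition G P" "F \<in> P" "e \<in> F" "(e, f) \<in> Theta G"
  shows "f \<in> F"
proof -
  have e: "e \<in> edges G" using assms(5) by (auto simp: Theta_def)
  then obtain x y where xy: "e = {x, y}" "x \<noteq> y" and v: "x \<in> verts G" "y \<in> verts G"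
    using assms(1) unfolding simple_graph_def by (auto simp: card_2_iff)
  have "vdist G x x = 0" "vdist G y y = 0"
    using vdist_le[OF walks_singleton[OF v(1)]] vdist_le[OF walks_singleton[OF v(2)]]
    by (auto simp: zero_enat_def[symmetric])
  moreover have "vdist G x y \<noteq> 0"
  proof
    assume z: "vdist G x y = 0"
    \<comment> \<open>The infimum over no walks is infinity, so distance 0 provides a walk, which
      then has a single vertex.\<close>
    then have "walks G x y \<noteq> {}" by (auto simp: vdist_def top_enat_def)
    then obtain p where "p \<in> walks G x y" "vdist G x y = enat (length p - 1)"
      by (rule vdist_attained)
    with z xy(2) show False
      by (cases p rule: remdups_adj.cases) (auto simp: walks_def zero_enat_def)
  qed
  ultimately have refl: "(e, e) \<in> Theta G" using e xy by (fastforce simp: Theta_def)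
  obtain F' where F': "F' \<in> P" "Theta_star G `` {e} \<subseteq> F'"
    using assms(2) quotientI[OF e, of "Theta_star G"] unfolding c_partition_def by blast
  have "e \<in> F'" "f \<in> F'" using F'(2) refl assms(5) by (auto simp: Theta_star_def)
  moreover have "disjoint P" using assms(2) by (auto simp: c_partition_def partition_on_def)
  ultimately show ?thesis using assms(3,4) F'(1) by (auto dest: disjointD)
qed

text \<open>Injectivity makes blocks with distinct indices distinct, hence disjoint, so membership
  of an edge becomes an equation between indices.\<close>

lemma ex1_class:
  assumes "c_partition G (F ` I)" "inj_on F I" "e \<in> edges G"
  shows "\<exists>j\<in>I. \<forall>i\<in>I. e \<in> F i \<longleftrightarrow> i = j"
proof -
  have P: "\<Union> (F ` I) = edges G" "disjoint (F ` I)"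
    using assms(1) by (auto simp: c_partition_def partition_on_def)
  then obtain j where j: "j \<in> I" "e \<in> F j" using assms(3) by auto
  have "e \<in> F i \<longleftrightarrow> i = j" if "i \<in> I" for i
  proof (cases "i = j")
    case False
    then have "F i \<noteq> F j" using inj_onD[OF assms(2) _ that j(1)] by blast
    then have "F i \<inter> F j = {}" using disjointD[OF P(2)] that j(1) by blast
    with j(2) False show ?thesis by blast
  qed (use j in simp)
  with j(1) show ?thesis by blast
qed

text \<open>After exchanging the sums, each step contributes through exactly one block. This serves
  both the integer sums \<open>h\<close> and the crossing counts.\<close>

lemma sum_step_sum_classes:
  assumes "c_partition G (F ` I)" "inj_on F I" "finite I" "successively (adj G) p"
  shows "(\<Sum>i\<in>I. step_sum (\<lambda>x y. if {x, y} \<in> F i then g x y else 0) p) = step_sum g p"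
proof -
  have "(\<Sum>i\<in>I. if {x, y} \<in> F i then g x y else 0) = g x y" if "adj G x y" for x y
  proof -
    have xy: "{x, y} \<in> edges G" using that by (simp add: adj_def)
    obtain j where j: "j \<in> I" "\<And>i. i \<in> I \<Longrightarrow> {x, y} \<in> F i \<longleftrightarrow> i = j"
      using ex1_class[OF assms(1,2), of "{x, y}"] xy by blast
    have "(\<Sum>i\<in>I. if {x, y} \<in> F i then g x y else 0) = (\<Sum>i\<in>I. if i = j then g x y else 0)"
      using j(2) by (intro sum.cong) auto
    with j(1) assms(3) show ?thesis by simp
  qed
  then show ?thesis
    unfolding step_sum_sum by (rule step_sum_cong[OF assms(4)])
qed

theorem vdist_eq_sum_quotients:
  assumes G: "simple_graph G" "connected_graph G"
    and F: "inj_on F I" "finite I" "c_partition G (F ` I)"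
    and u: "u \<in> verts G" and v: "v \<in> verts G"
  shows "vdist G u v = (\<Sum>i\<in>I. vdist (quotient_graph G (F i)) (ell G (F i) u) (ell G (F i) v))"
proof -
  have conn: "walks G x y \<noteq> {}" if "x \<in> verts G" "y \<in> verts G" for x y
    using G(2) that by (auto simp: connected_graph_def)
  \<comment> \<open>Distances are finite by connectedness; integers allow the differences in
    \<open>h\<close>.\<close>
  define D where "D x y = int (the_enat (vdist G x y))" for x y
  have fin: "vdist G x y = enat (nat (D x y))" if "x \<in> verts G" "y \<in> verts G" for x y
    using vdist_attained[OF conn[OF that]] by (metis D_def nat_int the_enat.simps)
  have D0: "D x x = 0" if "x \<in> verts G" for x
    using vdist_le[OF walks_singleton[OF that]] by (cases "vdist G x x") (auto simp: D_def)
  have D_commute: "D x y = D y x" for x y by (simp add: D_def vdist_commute)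
  have D_nonneg: "D x y \<ge> 0" for x y by (simp add: D_def)
  have D_adj: "D x z \<le> D y z + 1" if "adj G x y" "z \<in> verts G" for x y z
  proof -
    note xy = edge_vertices[OF G(1) that(1)]
    have "vdist G x z \<le> vdist G y z + 1"
      using vdist_adj_le[OF that(1) xy(1) conn[OF xy(2) that(2)]] .
    then show ?thesis
      using fin xy that(2) D_nonneg[of y z] by (simp add: one_enat_def)
  qed

  obtain P where P: "P \<in> walks G u v" "vdist G u v = enat (length P - 1)"
    using vdist_attained[OF conn[OF u v]] .
  then have sP: "successively (adj G) P" "P \<noteq> []" "hd P = u" "last P = v"
    by (auto simp: walks_def)

  \<comment> \<open>Each quotient gets its own optimal walk at first; that one shortest walk serves
    all of them follows only from the final count.\<close>
  have "\<exists>q. q \<in> walks G u v \<and> vdist (quotient_graph G (F i)) (ell G (F i) u) (ell G (F i) v)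
      = enat (crossings (F i) q)" for i
    using vdist_quotient_attained[OF G u v] by metis
  then obtain Q where Q: "\<And>i. Q i \<in> walks G u v"
    "\<And>i. vdist (quotient_graph G (F i)) (ell G (F i) u) (ell G (F i) v)
      = enat (crossings (F i) (Q i))" by metis

  define h where
    "h i z = step_sum (\<lambda>a b. if {a, b} \<in> F i then D z a - D z b else 0) P" for i z
  have tel: "step_sum (\<lambda>a b. D z a - D z b) P = D z u - D z v" for z
    using step_sum_telescope[of P "\<lambda>a. - D z a"] sP by simp
  have h_sum: "(\<Sum>i\<in>I. h i z) = D z u - D z v" for z
    unfolding h_def tel[symmetric] by (rule sum_step_sum_classes[OF F(3,1,2) sP(1)])

  \<comment> \<open>If exactly one of two edges is in \<open>F i\<close>, they lie in different
    blocks and so are not in relation \<Theta>.\<close>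
  have Theta: "(D y a - D y b) - (D x a - D x b) = 0"
    if "i \<in> I" "adj G x y" "adj G a b" "{x, y} \<in> F i \<longleftrightarrow> {a, b} \<notin> F i" for i x y a b
  proof -
    have "({x, y}, {a, b}) \<notin> Theta G"
    proof
      assume T: "({x, y}, {a, b}) \<in> Theta G"
      have e: "{x, y} \<in> edges G" "{a, b} \<in> edges G" using that(2,3) by (simp_all add: adj_def)
      obtain j where j: "j \<in> I" "\<And>i. i \<in> I \<Longrightarrow> {x, y} \<in> F i \<longleftrightarrow> i = j"
        using ex1_class[OF F(3,1) e(1)] by blast
      obtain k where k: "k \<in> I" "\<And>i. i \<in> I \<Longrightarrow> {a, b} \<in> F i \<longleftrightarrow> i = k"
        using ex1_class[OF F(3,1) e(2)] by blast
      have "{a, b} \<in> F j"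
        using c_partition_Theta[OF G(1) F(3) imageI[OF j(1)] _ T] j by simp
      then have "j = k" using k(2)[OF j(1)] by simp
      then have "{x, y} \<in> F i \<longleftrightarrow> {a, b} \<in> F i" using j(2) k(2) that(1) by simp
      with that(4) show False by blast
    qed
    then have "vdist G x a + vdist G y b = vdist G x b + vdist G y a"
      using that(2,3) unfolding Theta_def adj_def by blast
    then have "nat (D x a) + nat (D y b) = nat (D x b) + nat (D y a)"
      using fin edge_vertices[OF G(1) that(2)] edge_vertices[OF G(1) that(3)] by simp
    then show ?thesis
      using D_nonneg[of x a] D_nonneg[of y b] D_nonneg[of x b] D_nonneg[of y a] by linarith
  qed

  have h_step: "h i y - h i x \<le> (if {x, y} \<in> F i then 2 else 0)" if "i \<in> I" "adj G x y" for i x y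
  proof (cases "{x, y} \<in> F i")
    case True
    have "h i y - h i x = step_sum (\<lambda>a b. (D y a - D y b) - (D x a - D x b)) P"
      unfolding h_def step_sum_diff
    proof (rule step_sum_cong[OF sP(1)])
      show "(if {a, b} \<in> F i then D y a - D y b else 0) - (if {a, b} \<in> F i then D x a - D x b else 0)
        = (D y a - D y b) - (D x a - D x b)" if "adj G a b" for a b
        using Theta[OF \<open>i \<in> I\<close> \<open>adj G x y\<close> that] True by (cases "{a, b} \<in> F i") simp_all
    qed
    also have "\<dots> = (D y u - D y v) - (D x u - D x v)"
      by (simp only: tel[symmetric] step_sum_diff)
    \<comment> \<open>Moving along one edge changes the distances to \<open>u\<close> and to
      \<open>v\<close> by at most 1 each.\<close>
    also have "\<dots> \<le> 2"
      using D_adj[OF that(2) v] D_adj[OF that(2)[unfolded adj_commute[of G x y]] u] by linarith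
    finally show ?thesis using True by simp
  next
    case False
    have "h i y - h i x = step_sum (\<lambda>_ _. 0) P"
      unfolding h_def step_sum_diff
    proof (rule step_sum_cong[OF sP(1)])
      show "(if {a, b} \<in> F i then D y a - D y b else 0) - (if {a, b} \<in> F i then D x a - D x b else 0)
        = 0" if "adj G a b" for a b
        using Theta[OF \<open>i \<in> I\<close> \<open>adj G x y\<close> that] False by (cases "{a, b} \<in> F i") simp_all
    qed
    also have "\<dots> = 0" by (induction P rule: induct_list012) auto
    finally show ?thesis using False by simp
  qed
  have h_bound: "h i v - h i u \<le> 2 * int (crossings (F i) (Q i))" if "i \<in> I" for i
  proof -
    have Qi: "successively (adj G) (Q i)" "Q i \<noteq> []" "hd (Q i) = u" "last (Q i) = v"
      using Q(1)[of i] by (auto simp: walks_def)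
    have "h i v - h i u = step_sum (\<lambda>x y. h i y - h i x) (Q i)"
      using step_sum_telescope[OF Qi(2), of "h i"] Qi by simp
    also have "\<dots> \<le> 2 * int (crossings (F i) (Q i))"
      unfolding int_crossings by (rule step_sum_mono[OF Qi(1)]) (use h_step that in auto)
    finally show ?thesis .
  qed

  \<comment> \<open>By \<open>h_sum\<close>, the values at \<open>v\<close> add up to d(u,v) and
    those at \<open>u\<close> to -d(u,v); the resulting factor 2 cancels against that of
    \<open>h_bound\<close>.\<close>
  have "2 * D u v = (\<Sum>i\<in>I. h i v - h i u)"
    unfolding sum_subtractf h_sum using D0 u v D_commute by simp
  also have "\<dots> \<le> (\<Sum>i\<in>I. 2 * int (crossings (F i) (Q i)))"
    by (rule sum_mono) (rule h_bound)
  finally have "D u v \<le> int (\<Sum>i\<in>I. crossings (F i) (Q i))"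
    by (simp flip: sum_distrib_left)
  moreover have "D u v = int (length P - 1)" using P(2) by (simp add: D_def)
  ultimately have le: "length P - 1 \<le> (\<Sum>i\<in>I. crossings (F i) (Q i))" by (metis of_nat_le_iff)
  \<comment> \<open>\<open>Q i\<close> is optimal for its block, so \<open>P\<close> has at least as
    many crossings there; the blocks count every step of \<open>P\<close> once, which closes the
    chain.\<close>
  have "(\<Sum>i\<in>I. crossings (F i) (Q i)) \<le> (\<Sum>i\<in>I. crossings (F i) P)"
    using vdist_quotient_le[OF G(1) P(1)] Q(2) by (intro sum_mono) (metis enat_ord_simps(1))
  also have "\<dots> = length P - 1"
    using sum_step_sum_classes[OF F(3,1,2) sP(1), of "\<lambda>_ _. 1 :: nat"]
    unfolding crossings_def step_sum_1 of_bool_def .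
  finally have "length P - 1 = (\<Sum>i\<in>I. crossings (F i) (Q i))" using le by simp
  then show ?thesis by (simp add: P(2) Q(2) flip: of_nat_eq_enat)
qed

section \<open>The distance formula for edges\<close>

lemma edge_dist_eq_Min: "edge_dist G e f = Min ((\<lambda>(x, a). vdist G x a) ` (e \<times> f))"
  unfolding edge_dist_def by (rule arg_cong[where f = Min]) auto

text \<open>If the ends of an edge share a component, the pairs of ends merely repeat values, so one
  minimum covers all four cases of \<open>elem_dist\<close>.\<close>

lemma elem_dist_alpha:
  assumes "card e = 2" "card f = 2"
  shows "elem_dist H (alpha G F e) (alpha G F f)
    = Min ((\<lambda>(x, a). vdist H (ell G F x) (ell G F a)) ` (e \<times> f))"
proof -
  obtain x y a b where "e = {x, y}" "f = {a, b}" using assms by (auto simp: card_2_iff)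
  then show ?thesis
    by (auto simp: alpha_edge vertex_edge_dist_edge edge_dist_edge vdist_commute min.commute
        min.left_commute min.assoc insert_commute)
qed

theorem theorem3p2:
  fixes G :: "'a ugraph" and F :: "nat \<Rightarrow> 'a set set" and r :: nat and e f :: "'a set"
  assumes "simple_graph G"
    and "connected_graph G"
    and "inj_on F {1..r}"
    and "c_partition G (F ` {1..r})"
    and "e \<in> edges G"
    and "f \<in> edges G"
  shows "edge_dist G e f =
    (\<Sum>i=1..r. elem_dist (quotient_graph G (F i)) (alpha G (F i) e) (alpha G (F i) f))"
proof -
  define d where "d i = (\<lambda>(x, a). vdist (quotient_graph G (F i)) (ell G (F i) x) (ell G (F i) a))"
    for i
  have ef: "e \<subseteq> verts G" "f \<subseteq> verts G" "card e = 2" "card f = 2"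
    using assms(1,5,6) by (auto simp: simple_graph_def)
  then have fin: "finite (e \<times> f)" "e \<times> f \<noteq> {}"
    by (auto simp: card_2_iff)
  \<comment> \<open>An edge outside \<open>F i\<close> survives the deletion and keeps its ends in
    one component.\<close>
  have ell_const: "ell G (F i) x = ell G (F i) y"
    if "g \<in> edges G" "g \<notin> F i" "x \<in> g" "y \<in> g" for g i x y
  proof (cases "x = y")
    case False
    have "card g = 2" using assms(1) that(1) by (auto simp: simple_graph_def)
    with False that(3,4) have "g = {x, y}" by (auto simp: card_2_iff)
    with that ell_eq_adj[OF assms(1)] show ?thesis by (auto simp: adj_def)
  qed simp
  obtain j where j: "\<And>i. i \<in> {1..r} \<Longrightarrow> e \<in> F i \<longleftrightarrow> i = j"
    using ex1_class[OF assms(4,3,5)] by blast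
  obtain k where k: "\<And>i. i \<in> {1..r} \<Longrightarrow> f \<in> F i \<longleftrightarrow> i = k"
    using ex1_class[OF assms(4,3,6)] by blast
  have min: "\<exists>x a. x \<in> e \<and> a \<in> f \<and> (\<forall>z\<in>e \<times> f. d i (x, a) \<le> d i z)" for i
    using ex_min_if_finite[of "d i ` (e \<times> f)"] fin by (fastforce simp: not_less)
  obtain x a where xa: "x \<in> e" "a \<in> f"
    and le: "\<And>i z. i \<in> {1..r} \<Longrightarrow> z \<in> e \<times> f \<Longrightarrow> d i (x, a) \<le> d i z"
  proof -
    obtain x1 a1 where m1: "x1 \<in> e" "a1 \<in> f" "\<forall>z\<in>e \<times> f. d j (x1, a1) \<le> d j z" using min by blast
    obtain x2 a2 where m2: "x2 \<in> e" "a2 \<in> f" "\<forall>z\<in>e \<times> f. d k (x2, a2) \<le> d k z" using min by blast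
    \<comment> \<open>If \<open>j = k\<close>, both ends must come from the same minimal pair;
      otherwise the choice of \<open>x1\<close> matters only for \<open>j\<close> and that of
      \<open>a2\<close> only for \<open>k\<close>.\<close>
    define a where "a = (if j = k then a1 else a2)"
    have a: "a \<in> f" using m1 m2 by (simp add: a_def)
    have "d i (x1, a) \<le> d i z" if i: "i \<in> {1..r}" and z: "z \<in> e \<times> f" for i z
    proof -
      obtain x' a' where z': "z = (x', a')" "x' \<in> e" "a' \<in> f" using z by blast
      have e: "ell G (F i) s = ell G (F i) t" if "i \<noteq> j" "s \<in> e" "t \<in> e" for s t
        using ell_const[OF assms(5)] j[OF i] that by blast
      have f: "ell G (F i) s = ell G (F i) t" if "i \<noteq> k" "s \<in> f" "t \<in> f" for s t
        using ell_const[OF assms(6)] k[OF i] that by blast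
      consider "i = j" "i = k" | "i = j" "i \<noteq> k" | "i \<noteq> j" "i = k" | "i \<noteq> j" "i \<noteq> k" by blast
      then show ?thesis
      proof cases
        case 1
        then show ?thesis using bspec[OF m1(3) z] by (simp add: a_def)
      next
        case 2
        then have "d i (x1, a) = d i (x1, a1)"
          using f[of a a1] a m1(2) by (simp add: d_def)
        then show ?thesis using bspec[OF m1(3) z] 2 by simp
      next
        case 3
        then have "d i (x1, a) = d i (x2, a2)"
          using e[of x1 x2] m1(1) m2(1) by (auto simp: d_def a_def)
        then show ?thesis using bspec[OF m2(3) z] 3 by simp
      next
        case 4
        then show ?thesis
          using e[of x1 x'] f[of a a'] m1(1) a z' by (simp add: d_def)
      qed
    qed
    then show ?thesis using that m1(1) a by blast
  qed
  have vd: "vdist G s t = (\<Sum>i=1..r. d i (s, t))" if "s \<in> e" "t \<in> f" for s t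
    using vdist_eq_sum_quotients[OF assms(1-3) _ assms(4), of s t] that ef by (auto simp: d_def)
  \<comment> \<open>A pair that minimizes every summand also minimizes the sum.\<close>
  have "edge_dist G e f = vdist G x a"
    unfolding edge_dist_eq_Min
  proof (rule Min_eqI)
    show "vdist G x a \<le> y" if "y \<in> (\<lambda>(x, a). vdist G x a) ` (e \<times> f)" for y
      using that le xa by (auto simp: vd intro!: sum_mono)
  qed (use fin xa in auto)
  also have "\<dots> = (\<Sum>i=1..r. d i (x, a))" using vd xa .
  also have "\<dots> = (\<Sum>i=1..r. Min (d i ` (e \<times> f)))"
    by (intro sum.cong refl Min_eqI[symmetric]) (use fin xa le in auto)
  finally show ?thesis by (simp add: elem_dist_alpha[OF ef(3,4)] d_def)
qed

end
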